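(* Let $\omega$ be an environment, let $(X_n)_{n\ge 0}$ be the associated walk, and let $\beta:\mathbb{Z}_+\to(1,\infty)$ satisfy $\beta_*:=\inf_{x\in\mathbb{Z}_+}\beta(x)>1$. Assume that $A_x<\infty$ for all $x\in\mathbb{Z}_+$ and that there is $\lambda$ with $0\le\lambda<\min\{1,\beta_*-1\}$ such that $A_x=O(x^\lambda)$. Assume further that there exists $\mu>1$ such that $\frac1x\sum_{w=0}^{x-1}m_w=\mu+\theta_1(x)$ with $\theta_1(x)=o(1)$ as $x\to\infty$. Then $$\lim_{n\to\infty}n^{-1}X_n=\mu^{-1}\qquad P_\omega\text{-almost surely.}$$
   Context: $\mathbb{Z}_+=\{0,1,2,\dots\}$. An environment is a family $\omega=(\omega^x)_{x\in\mathbb{Z}_+}$ of real sequences $\omega^x=(\omega^x_n)_{n\ge0}$ such that, for every $x$, $\omega^x_0=1$, $0<\omega^x_{n+1}<\omega^x_n$ for all $n\ge0$, and $\lim_{n\to\infty}\omega^x_n=0$. Given $\omega$, let $Z_n=(X_n,Y_n)$, $n\ge0$, be the Markov chain on $\mathbb{Z}_+\times\mathbb{Z}_+$ with initial distribution $P_\omega(Z_0=(0,y))=\omega^0_y-\omega^0_{y+1}$, $y\in\mathbb{Z}_+$, and transitions: from $(x',y')$ with $y'>0$ the chain moves to $(x',y'-1)$ with probability $1$; from $(x',0)$ it moves to $(x'+1,y)$ with probability $\omega^{x'+1}_y-\omega^{x'+1}_{y+1}$, $y\in\mathbb{Z}_+$. $P_\omega$ denotes the law of this chain. The walk is the first coordinate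 $(X_n)$. Notation: $A_x=\max\{\sup_{n\ge1}n^{\beta(x)}\omega^x_n,\,1\}$ and $m_x=\sum_{n=0}^\infty\omega^x_n$. The statement $A_x=O(x^\lambda)$ means that there is a constant $C$ with $A_x\le Cx^\lambda$ for all $x\ge1$. *)

theory Defs
  imports "HOL-Probability.Probability"
begin

definition environment :: "(nat \<Rightarrow> nat \<Rightarrow> real) \<Rightarrow> bool" where
  "environment \<omega> \<longleftrightarrow>
     (\<forall>x. \<omega> x 0 = 1 \<and> (\<forall>n. 0 < \<omega> x (Suc n) \<and> \<omega> x (Suc n) < \<omega> x n) \<and> \<omega> x \<longlonglongrightarrow> 0)"

text \<open>
  The process \<open>Z\<close> on the probability space \<open>M\<close> is a Markov chain with initial distribution \<open>\<nu>\<close>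
  and one-step transition probabilities \<open>p\<close>. The state space is countable, so conditioning is on
  initial path segments of positive probability.
\<close>
definition markov_chain ::
  "'a measure \<Rightarrow> ('s \<Rightarrow> real) \<Rightarrow> ('s \<Rightarrow> 's \<Rightarrow> real) \<Rightarrow> (nat \<Rightarrow> 'a \<Rightarrow> 's::countable) \<Rightarrow> bool" where
  "markov_chain M \<nu> p Z \<longleftrightarrow>
     prob_space M \<and>
     (\<forall>n. Z n \<in> M \<rightarrow>\<^sub>M count_space UNIV) \<and>
     (\<forall>z. \<P>(s in M. Z 0 s = z) = \<nu> z) \<and>
     (\<forall>n zs z. \<P>(s in M. \<forall>i\<le>n. Z i s = zs i) > 0 \<longrightarrow>
        \<P>(s in M. Z (Suc n) s = z \<bar> \<forall>i\<le>n. Z i s = zs i) = p (zs n) z)"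

definition init_prob :: "(nat \<Rightarrow> nat \<Rightarrow> real) \<Rightarrow> nat \<times> nat \<Rightarrow> real" where
  "init_prob \<omega> = (\<lambda>(x, y). if x = 0 then \<omega> 0 y - \<omega> 0 (Suc y) else 0)"

definition trans_prob :: "(nat \<Rightarrow> nat \<Rightarrow> real) \<Rightarrow> nat \<times> nat \<Rightarrow> nat \<times> nat \<Rightarrow> real" where
  "trans_prob \<omega> = (\<lambda>(x', y') (x, y).
     if y' > 0 then (if x = x' \<and> y = y' - 1 then 1 else 0)
     else (if x = Suc x' then \<omega> x y - \<omega> x (Suc y) else 0))"

text \<open>The supremum is taken in the extended reals, so that finiteness is a genuine condition.\<close>
definition tail_const :: "(nat \<Rightarrow> real) \<Rightarrow> (nat \<Rightarrow> nat \<Rightarrow> real) \<Rightarrow> nat \<Rightarrow> ereal" where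
  "tail_const \<beta> \<omega> x = max (SUP n\<in>{1..}. ereal (real n powr \<beta> x * \<omega> x n)) 1"

text \<open>
  The series converges whenever \<open>tail_const \<beta> \<omega> x < \<infinity>\<close> for some \<open>\<beta>\<close> with \<open>\<beta> x > 1\<close>.
  Outside that case a divergent series would get an unspecified value.
\<close>
definition mean_time :: "(nat \<Rightarrow> nat \<Rightarrow> real) \<Rightarrow> nat \<Rightarrow> real" where
  "mean_time \<omega> x = (\<Sum>n. \<omega> x n)"

end

theory Submission imports Defs begin

text \<open>
  The holding times \<open>T x\<close> (one plus the level at which the chain enters column \<open>x\<close>) are independent
  with \<open>P(T x > n) = \<omega> x n\<close> and mean \<open>m x\<close>. Since \<open>l < min 1 (INF \<beta> - 1)\<close>, the probabilities
  \<open>P(T x > x)\<close> are summable, the truncation errors \<open>E(T x; T x > x)\<close> vanish, and the sum of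
  \<open>E((T i)\<^sup>2; T i \<le> i)\<close> over \<open>i < n\<close> is \<open>O(n powr (2 - \<delta>))\<close> for some \<open>\<delta> > 0\<close>. A strong law for
  uncorrelated nonnegative variables and Borel-Cantelli give \<open>T 0 + \<dots> + T (x - 1) \<sim> \<mu> x\<close>, and
  inverting this relation between time and position gives the speed.
\<close>

subsection \<open>Limits of averages\<close>

text \<open>If \<open>j n < K\<close>, then \<open>n\<close> lies below one of \<open>a 1\<close>,
  ..., \<open>a K\<close>. Since \<open>a\<close> may fail to be monotone, the sum of these values
  serves as their common bound.\<close>

lemma filterlim_index_at_top:
  fixes a j :: "nat \<Rightarrow> nat"
  assumes "\<And>n. n < a (Suc (j n))"
  shows "filterlim j at_top at_top"
  unfolding filterlim_at_top
proof
  fix K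
  have "K \<le> j n" if "n \<ge> (\<Sum>i\<le>Suc K. a i)" for n
  proof (rule ccontr)
    assume "\<not> K \<le> j n"
    then have "a (Suc (j n)) \<le> (\<Sum>i\<le>Suc K. a i)"
      by (intro member_le_sum) auto
    then show False using assms[of n] that by simp
  qed
  then show "\<forall>\<^sub>F n in sequentially. K \<le> j n"
    unfolding eventually_sequentially by blast
qed

text \<open>Consecutive \<open>p\<close>-th powers have a ratio tending to 1, so monotonicity of
  \<open>S\<close> controls the averages between two of them.\<close>

lemma LIMSEQ_ratio_power_subseq:
  fixes S :: "nat \<Rightarrow> real"
  assumes S: "mono S" "\<And>n. 0 \<le> S n" and p: "p \<ge> 1"
    and lim: "(\<lambda>j. S (j ^ p) / real (j ^ p)) \<longlonglongrightarrow> \<mu>"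
  shows "(\<lambda>n. S n / real n) \<longlonglongrightarrow> \<mu>"
proof -
  \<comment> \<open>The witness is the integer part of the \<open>p\<close>-th root of
    \<open>n\<close>; the candidates are bounded by \<open>n\<close> because
    \<open>p \<ge> 1\<close>.\<close>
  have ex: "\<exists>j. j ^ p \<le> n \<and> n < Suc j ^ p" for n
  proof -
    define j where "j = Max {j. j ^ p \<le> n}"
    have "k \<le> n" if "k ^ p \<le> n" for k
    proof (cases "k = 0")
      case False
      then have "k \<le> k ^ p" using p by (intro self_le_power) auto
      then show ?thesis using that by (rule order_trans)
    qed simp
    then have "{j. j ^ p \<le> n} \<subseteq> {..n}" by blast
    then have fin: "finite {j. j ^ p \<le> n}" by (rule finite_subset) simp
    have "0 \<in> {j. j ^ p \<le> n}" using p by (simp add: power_0_left)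
    then have "j \<in> {j. j ^ p \<le> n}" unfolding j_def using fin by (intro Max_in) blast+
    moreover have "Suc j \<notin> {j. j ^ p \<le> n}"
      using Max_ge[OF fin, of "Suc j"] j_def by auto
    ultimately show ?thesis by auto
  qed
  then obtain j where j: "\<And>n. j n ^ p \<le> n" "\<And>n. n < Suc (j n) ^ p" by metis
  have jtop: "filterlim j at_top at_top"
    by (rule filterlim_index_at_top[where a = "\<lambda>k. k ^ p"]) (use j in auto)
  define r where "r k = S (k ^ p) / real (k ^ p)" for k
  define q where "q k = (real (Suc k) / real k) ^ p" for k
  have q: "q \<longlonglongrightarrow> 1"
  proof -
    have "(\<lambda>k. (real (Suc k) / real k) ^ p) \<longlonglongrightarrow> 1 ^ p"
      by (intro tendsto_power LIMSEQ_Suc_n_over_n)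
    then show ?thesis by (simp add: q_def[abs_def])
  qed
  have r: "r \<longlonglongrightarrow> \<mu>" using lim by (simp add: r_def[abs_def])
  \<comment> \<open>With \<open>k = j n\<close>, the inequalities
    \<open>k ^ p \<le> n < Suc k ^ p\<close> place \<open>S n / n\<close> between
    \<open>S (k ^ p) / Suc k ^ p\<close> and \<open>S (Suc k ^ p) / k ^ p\<close>. The factor
    \<open>q k\<close> exchanges the two denominators.\<close>
  have lo: "(\<lambda>n. r (j n) / q (j n)) \<longlonglongrightarrow> \<mu> / 1"
    by (intro tendsto_divide filterlim_compose[OF r jtop] filterlim_compose[OF q jtop]) auto
  have hi: "(\<lambda>n. r (Suc (j n)) * q (j n)) \<longlonglongrightarrow> \<mu> * 1"
    by (intro tendsto_mult filterlim_compose[OF LIMSEQ_Suc[OF r] jtop] filterlim_compose[OF q jtop])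
  have pos: "\<forall>\<^sub>F n in sequentially. 1 \<le> j n" using jtop unfolding filterlim_at_top by blast
  have "\<forall>\<^sub>F n in sequentially. r (j n) / q (j n) \<le> S n / real n"
    using pos
  proof eventually_elim
    case (elim n)
    then have jp: "0 < real (j n) ^ p" by simp
    have "0 < j n ^ p" using elim by simp
    then have n: "0 < n" using j(1)[of n] by linarith
    have "r (j n) / q (j n) = S (j n ^ p) / real (Suc (j n)) ^ p"
      using jp by (simp add: r_def q_def power_divide)
    also have "\<dots> \<le> S n / real n"
      using n j[of n] monoD[OF S(1) j(1)[of n]] S(2)
      by (intro frac_le) (auto simp flip: of_nat_power simp del: of_nat_Suc power_Suc)
    finally show ?case .
  qed
  moreover have "\<forall>\<^sub>F n in sequentially. S n / real n \<le> r (Suc (j n)) * q (j n)"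
    using pos
  proof eventually_elim
    case (elim n)
    then have jp: "0 < real (j n) ^ p" by simp
    have "0 < j n ^ p" using elim by simp
    then have n: "0 < n" using j(1)[of n] by linarith
    have sp: "real (Suc (j n)) ^ p > 0" by simp
    have "S n / real n \<le> S (Suc (j n) ^ p) / real (j n) ^ p"
      using jp n j[of n] monoD[OF S(1), of n "Suc (j n) ^ p"] S(2)
      by (intro frac_le) (auto simp flip: of_nat_power simp del: of_nat_Suc power_Suc)
    also have "\<dots> = r (Suc (j n)) * q (j n)"
      using jp sp unfolding r_def q_def power_divide of_nat_power by (simp add: field_simps)
    finally show ?case .
  qed
  ultimately show ?thesis
    using tendsto_sandwich[of "\<lambda>n. r (j n) / q (j n)" "\<lambda>n. S n / real n" sequentially
        "\<lambda>n. r (Suc (j n)) * q (j n)" \<mu>] lo hi by simp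
qed

text \<open>Dividing \<open>t (N n) \<le> n < t (Suc (N n))\<close> by \<open>N n\<close> traps
  \<open>n / N n\<close> between two sequences with limit \<mu>, because \<open>N n\<close> tends to
  infinity.\<close>

lemma LIMSEQ_inverse_count:
  fixes t N :: "nat \<Rightarrow> nat"
  assumes t: "(\<lambda>x. real (t x) / real x) \<longlonglongrightarrow> \<mu>" and \<mu>: "\<mu> > 0"
    and N: "\<And>n. t (N n) \<le> n" "\<And>n. n < t (Suc (N n))"
  shows "(\<lambda>n. inverse (real n) * real (N n)) \<longlonglongrightarrow> inverse \<mu>"
proof -
  have Ntop: "filterlim N at_top at_top"
    by (rule filterlim_index_at_top[where a = t]) (rule N)
  have pos: "\<forall>\<^sub>F n in sequentially. 1 \<le> N n" using Ntop unfolding filterlim_at_top by blast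
  have lo: "(\<lambda>n. real (t (N n)) / real (N n)) \<longlonglongrightarrow> \<mu>"
    by (rule filterlim_compose[OF t Ntop])
  have "(\<lambda>n. real (t (Suc (N n))) / real (Suc (N n)) * (real (Suc (N n)) / real (N n))) \<longlonglongrightarrow> \<mu> * 1"
    by (intro tendsto_mult filterlim_compose[OF LIMSEQ_Suc[OF t] Ntop]
        filterlim_compose[OF LIMSEQ_Suc_n_over_n Ntop])
  then have hi: "(\<lambda>n. real (t (Suc (N n))) / real (N n)) \<longlonglongrightarrow> \<mu>"
    by (simp del: of_nat_Suc)
  have "(\<lambda>n. real n / real (N n)) \<longlonglongrightarrow> \<mu>"
  proof (rule tendsto_sandwich[OF _ _ lo hi])
    \<comment> \<open>For \<open>N n = 0\<close> all quotients are 0 by the convention on division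
      by zero, so both inequalities hold for every \<open>n\<close>.\<close>
    show "\<forall>\<^sub>F n in sequentially. real (t (N n)) / real (N n) \<le> real n / real (N n)"
      using N(1) by (intro always_eventually) (auto intro!: divide_right_mono)
    show "\<forall>\<^sub>F n in sequentially. real n / real (N n) \<le> real (t (Suc (N n))) / real (N n)"
      using N(2)[THEN less_imp_le] by (intro always_eventually) (auto intro!: divide_right_mono)
  qed
  then have "(\<lambda>n. inverse (real n / real (N n))) \<longlonglongrightarrow> inverse \<mu>"
    using \<mu> by (intro tendsto_inverse) auto
  then show ?thesis by (simp add: divide_inverse mult.commute)
qed

lemma LIMSEQ_cesaro_null:
  fixes a :: "nat \<Rightarrow> real"
  assumes "a \<longlonglongrightarrow> 0"
  shows "(\<lambda>n. (\<Sum>i<n. a i) / real n) \<longlonglongrightarrow> 0"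
proof (rule LIMSEQ_I)
  fix e :: real assume e: "0 < e"
  then obtain N where N: "\<And>n. n \<ge> N \<Longrightarrow> \<bar>a n\<bar> < e / 2"
    using LIMSEQ_D[OF assms, of "e / 2"] by auto
  define B where "B = (\<Sum>i<N. \<bar>a i\<bar>)"
  obtain N' where N': "real N' > 2 * B / e" using reals_Archimedean2 by blast
  have "norm ((\<Sum>i<n. a i) / real n - 0) < e" if n: "n \<ge> max (Suc N) N'" for n
  proof -
    have n0: "0 < real n" "N \<le> n" using n by auto
    have "\<bar>\<Sum>i<n. a i\<bar> \<le> (\<Sum>i<n. \<bar>a i\<bar>)" by (rule sum_abs)
    also have "\<dots> = B + (\<Sum>i=N..<n. \<bar>a i\<bar>)"
      unfolding B_def using n0 by (metis lessThan_atLeast0 sum.atLeastLessThan_concat zero_le)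
    also have "(\<Sum>i=N..<n. \<bar>a i\<bar>) \<le> (\<Sum>i=N..<n. e / 2)"
      using N by (intro sum_mono) (auto intro: less_imp_le)
    also have "\<dots> \<le> real n * (e / 2)" using e by (simp add: mult_right_mono)
    finally have 1: "\<bar>\<Sum>i<n. a i\<bar> \<le> B + real n * (e / 2)" by simp
    have "2 * B / e < real n" using N' n by (simp add: le_less_trans less_le_trans)
    then have "B < real n * (e / 2)" using e by (simp add: field_simps)
    then have "\<bar>\<Sum>i<n. a i\<bar> < real n * e" using 1 by (simp add: field_simps)
    then show ?thesis using n0 by (simp add: abs_divide field_simps)
  qed
  then show "\<exists>no. \<forall>n\<ge>no. norm ((\<Sum>i<n. a i) / real n - 0) < e" by blast
qed

text \<open>By monotone convergence the sum of the squares has finite expectation. It is therefore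
  finite almost everywhere, and its terms tend to 0.\<close>

lemma AE_LIMSEQ_0_of_summable_second_moment:
  fixes f :: "nat \<Rightarrow> 'a \<Rightarrow> real"
  assumes int: "\<And>n. integrable M (\<lambda>s. (f n s)\<^sup>2)"
    and b: "\<And>n. (\<integral>s. (f n s)\<^sup>2 \<partial>M) \<le> b n" and "summable b"
  shows "AE s in M. (\<lambda>n. f n s) \<longlonglongrightarrow> 0"
proof -
  have sm: "summable (\<lambda>n. \<integral>s. (f n s)\<^sup>2 \<partial>M)"
    using b by (intro summable_comparison_test'[OF \<open>summable b\<close>, of 0]) auto
  have "(\<integral>\<^sup>+ s. (\<Sum>n. ennreal ((f n s)\<^sup>2)) \<partial>M) = (\<Sum>n. \<integral>\<^sup>+ s. ennreal ((f n s)\<^sup>2) \<partial>M)"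
    using int by (intro nn_integral_suminf) (auto dest!: borel_measurable_integrable)
  also have "\<dots> = (\<Sum>n. ennreal (\<integral>s. (f n s)\<^sup>2 \<partial>M))"
    using int by (intro suminf_cong nn_integral_eq_integral) auto
  also have "\<dots> = ennreal (\<Sum>n. \<integral>s. (f n s)\<^sup>2 \<partial>M)"
    using sm by (intro suminf_ennreal2) auto
  finally have "(\<integral>\<^sup>+ s. (\<Sum>n. ennreal ((f n s)\<^sup>2)) \<partial>M) \<noteq> \<infinity>" by simp
  then have "AE s in M. (\<Sum>n. ennreal ((f n s)\<^sup>2)) \<noteq> \<infinity>"
    using int by (intro nn_integral_PInf_AE) (auto dest!: borel_measurable_integrable)
  then show ?thesis
  proof eventually_elim
    case (elim s)
    then have "summable (\<lambda>n. (f n s)\<^sup>2)" by (intro summable_suminf_not_top) auto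
    then have "(\<lambda>n. (f n s)\<^sup>2) \<longlonglongrightarrow> 0" by (rule summable_LIMSEQ_zero)
    then have "(\<lambda>n. sqrt ((f n s)\<^sup>2)) \<longlonglongrightarrow> sqrt 0" by (intro tendsto_real_sqrt)
    then show ?case by (simp add: tendsto_rabs_zero_iff)
  qed
qed

subsection \<open>A strong law for uncorrelated variables\<close>

text \<open>Nonnegativity makes the partial sums monotone, so that convergence along \<open>j ^ p\<close> suffices;
  for \<open>p * \<delta> \<ge> 2\<close> the second moments are summable along this subsequence.\<close>
lemma (in prob_space) strong_law_uncorrelated_nonneg:
  fixes U :: "nat \<Rightarrow> 'a \<Rightarrow> real"
  assumes nonneg: "\<And>i s. 0 \<le> U i s"
    and int: "\<And>i. integrable M (U i)" "\<And>i j. integrable M (\<lambda>s. U i s * U j s)"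
    and uncorr: "\<And>i j. i \<noteq> j \<Longrightarrow> expectation (\<lambda>s. U i s * U j s) = expectation (U i) * expectation (U j)"
    and var: "\<And>n. (\<Sum>i<n. expectation (\<lambda>s. (U i s)\<^sup>2)) \<le> K * real n powr (2 - \<delta>)" and \<delta>: "\<delta> > 0"
    and mean: "(\<lambda>n. (\<Sum>i<n. expectation (U i)) / real n) \<longlonglongrightarrow> \<mu>"
  shows "AE s in M. (\<lambda>n. (\<Sum>i<n. U i s) / real n) \<longlonglongrightarrow> \<mu>"
proof -
  define V where "V i s = U i s - expectation (U i)" for i s
  define D where "D n s = (\<Sum>i<n. V i s)" for n s
  have intV: "integrable M (\<lambda>s. V i s * V j s)" for i j
    unfolding V_def by (simp add: algebra_simps int)
  have EV: "expectation (\<lambda>s. V i s * V j s) =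
      expectation (\<lambda>s. U i s * U j s) - expectation (U i) * expectation (U j)" for i j
    unfolding V_def by (simp add: algebra_simps int prob_space)
  have D2: "(D n s)\<^sup>2 = (\<Sum>i<n. \<Sum>j<n. V i s * V j s)" for n s
    unfolding D_def power2_eq_square sum_product ..
  have intD: "integrable M (\<lambda>s. (D n s)\<^sup>2)" for n
    unfolding D2 by (intro Bochner_Integration.integrable_sum intV)
  \<comment> \<open>Only the diagonal of the double sum survives, and each variance is at most the
    second moment.\<close>
  have ED: "expectation (\<lambda>s. (D n s)\<^sup>2) \<le> K * real n powr (2 - \<delta>)" for n
  proof -
    have "expectation (\<lambda>s. (D n s)\<^sup>2) = (\<Sum>i<n. \<Sum>j<n. expectation (\<lambda>s. V i s * V j s))"
      unfolding D2 by (simp add: intV)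
    also have "\<dots> = (\<Sum>i<n. \<Sum>j<n. if j = i then expectation (\<lambda>s. V i s * V i s) else 0)"
      using uncorr by (intro sum.cong) (auto simp: EV)
    also have "\<dots> = (\<Sum>i<n. expectation (\<lambda>s. V i s * V i s))"
      by (intro sum.cong) (auto simp: sum.delta)
    also have "\<dots> \<le> (\<Sum>i<n. expectation (\<lambda>s. (U i s)\<^sup>2))"
      by (intro sum_mono) (simp add: EV power2_eq_square)
    finally show ?thesis using var[of n] by simp
  qed
  obtain p :: nat where p: "real p > 2 / \<delta>" using reals_Archimedean2 by blast
  then have p0: "p > 0" and p\<delta>: "real p * \<delta> > 2"
    using \<delta> by (auto simp: field_simps intro: gr0I)
  have "AE s in M. (\<lambda>j. D (j ^ p) s / real (j ^ p)) \<longlonglongrightarrow> 0"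
  proof (rule AE_LIMSEQ_0_of_summable_second_moment)
    show "integrable M (\<lambda>s. (D (j ^ p) s / real (j ^ p))\<^sup>2)" for j
      unfolding power_divide using intD by simp
    show "expectation (\<lambda>s. (D (j ^ p) s / real (j ^ p))\<^sup>2) \<le> K * real j powr (- (real p * \<delta>))" for j
    \<comment> \<open>At \<open>j = 0\<close> both sides are 0: the sum \<open>D 0\<close> is empty
      and \<open>0 powr a = 0\<close>.\<close>
    proof (cases "j = 0")
      case True
      then show ?thesis using p0 by (simp add: D_def power_0_left)
    next
      case False
      then have j: "real j > 0" by simp
      have "expectation (\<lambda>s. (D (j ^ p) s / real (j ^ p))\<^sup>2) =
          expectation (\<lambda>s. (D (j ^ p) s)\<^sup>2) / (real (j ^ p))\<^sup>2"
        unfolding power_divide by simp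
      also have "\<dots> \<le> K * real (j ^ p) powr (2 - \<delta>) / (real (j ^ p))\<^sup>2"
        by (intro divide_right_mono ED) auto
      also have "\<dots> = K * (real j powr (real p * (2 - \<delta>)) / real j powr (real p * 2))"
        using j by (simp add: powr_powr flip: powr_realpow)
      also have "\<dots> = K * real j powr (- (real p * \<delta>))"
        using j by (simp add: algebra_simps flip: powr_diff)
      finally show ?thesis .
    qed
    show "summable (\<lambda>j. K * real j powr (- (real p * \<delta>)))"
      using p\<delta> by (intro summable_mult) (simp add: summable_real_powr_iff)
  qed
  then show ?thesis
  proof eventually_elim
    case (elim s)
    have sub: "filterlim (\<lambda>j. j ^ p) at_top (at_top :: nat filter)"
    proof (rule filterlim_at_top_mono[OF filterlim_ident])
      show "\<forall>\<^sub>F j :: nat in sequentially. j \<le> j ^ p"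
        using p0 by (intro eventually_at_top_linorderI[of 1]) (auto intro: self_le_power)
    qed
    \<comment> \<open>Adding the averaged means back to the centred sums recovers the averages of
      \<open>U\<close> along the subsequence.\<close>
    have "(\<lambda>j. D (j ^ p) s / real (j ^ p) + (\<Sum>i<j ^ p. expectation (U i)) / real (j ^ p)) \<longlonglongrightarrow> 0 + \<mu>"
      by (intro tendsto_add elim filterlim_compose[OF mean sub])
    then have "(\<lambda>j. (\<Sum>i<j ^ p. U i s) / real (j ^ p)) \<longlonglongrightarrow> \<mu>"
      by (simp add: D_def V_def sum_subtractf flip: add_divide_distrib)
    then show ?case
      using p0 nonneg
      by (intro LIMSEQ_ratio_power_subseq[of "\<lambda>n. \<Sum>i<n. U i s"])
        (auto intro!: monoI sum_mono2 sum_nonneg)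
  qed
qed

subsection \<open>Power-law tails\<close>

text \<open>The exponent is split in two: \<open>1 + \<epsilon>\<close> leaves a convergent series,
  and the remaining factor \<open>k powr (1 - \<gamma>)\<close> is increasing, hence at most
  \<open>i powr (1 - \<gamma>)\<close>. The factor 3 comes from \<open>2 * k + 1 \<le> 3 * k\<close>
  for \<open>k \<ge> 1\<close>; the term \<open>k = 0\<close>, where the decay hypothesis is silent,
  is kept apart.\<close>

lemma weighted_tail_sum_bound:
  fixes w :: "nat \<Rightarrow> real"
  assumes w: "\<And>n. n \<ge> 1 \<Longrightarrow> w n \<le> c * real n powr (- (1 + \<epsilon> + \<gamma>))" and "c \<ge> 0"
    and \<epsilon>: "\<epsilon> > 0" and \<gamma>: "\<gamma> < 1"
  shows "(\<Sum>k<i. (2 * real k + 1) * w k) \<le> \<bar>w 0\<bar> + 3 * c * (\<Sum>n. real n powr (- (1 + \<epsilon>))) * real i powr (1 - \<gamma>)"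
proof -
  define z where "z n = real n powr (- (1 + \<epsilon>))" for n :: nat
  have z: "summable z" unfolding z_def using \<epsilon> by (simp add: summable_real_powr_iff)
  have "(2 * real k + 1) * w k \<le> (if k = 0 then \<bar>w 0\<bar> else 0) + 3 * c * real i powr (1 - \<gamma>) * z k"
    if k: "k < i" for k
  proof (cases "k = 0")
    case True
    then show ?thesis by (simp add: z_def)
  next
    case False
    then have k1: "1 \<le> k" "0 < real k" by auto
    have "(2 * real k + 1) * w k \<le> (2 * real k + 1) * (c * real k powr (- (1 + \<epsilon> + \<gamma>)))"
      using w[OF k1(1)] by (intro mult_left_mono) auto
    also have "\<dots> \<le> (3 * real k) * (c * real k powr (- (1 + \<epsilon> + \<gamma>)))"
      using k1 \<open>c \<ge> 0\<close> by (intro mult_right_mono) auto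
    also have "\<dots> = 3 * c * (real k powr 1 * real k powr (- (1 + \<epsilon> + \<gamma>)))" using k1 by simp
    also have "\<dots> = 3 * c * (real k powr (1 - \<gamma>) * z k)"
      unfolding z_def powr_add[symmetric] by (rule arg_cong[where f = "\<lambda>a. 3 * c * real k powr a"]) simp
    also have "\<dots> \<le> 3 * c * (real i powr (1 - \<gamma>) * z k)"
      using k \<gamma> \<open>c \<ge> 0\<close> by (intro mult_left_mono mult_right_mono powr_mono2) (auto simp: z_def)
    finally show ?thesis using False by (simp add: mult_ac)
  qed
  then have "(\<Sum>k<i. (2 * real k + 1) * w k)
      \<le> (\<Sum>k<i. (if k = 0 then \<bar>w 0\<bar> else 0) + 3 * c * real i powr (1 - \<gamma>) * z k)"
    by (intro sum_mono) auto
  also have "\<dots> = (\<Sum>k<i. if k = 0 then \<bar>w 0\<bar> else 0) + 3 * c * real i powr (1 - \<gamma>) * (\<Sum>k<i. z k)"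
    by (simp add: sum.distrib sum_distrib_left)
  also have "(\<Sum>k<i. if k = 0 then \<bar>w 0\<bar> else 0) \<le> \<bar>w 0\<bar>" by (simp add: sum.delta)
  also have "3 * c * real i powr (1 - \<gamma>) * (\<Sum>k<i. z k) \<le> 3 * c * real i powr (1 - \<gamma>) * (\<Sum>k. z k)"
    using \<open>c \<ge> 0\<close> by (intro mult_left_mono sum_le_suminf z) (auto simp: z_def)
  finally show ?thesis by (simp add: z_def[abs_def] mult_ac)
qed

text \<open>From index \<open>i\<close> on, the factor with exponent \<open>- \<gamma>\<close> is at
  most its value at \<open>i\<close>, and what remains is bounded by the full convergent
  series.\<close>

lemma tail_sum_bound:
  fixes w :: "nat \<Rightarrow> real"
  assumes w: "\<And>n. n \<ge> 1 \<Longrightarrow> w n \<le> c * real n powr (- (1 + \<epsilon> + \<gamma>))" and nn: "\<And>n. 0 \<le> w n"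
    and "c \<ge> 0" and \<epsilon>: "\<epsilon> > 0" and \<gamma>: "\<gamma> \<ge> 0" and i: "i \<ge> 1"
  shows "summable w"
    and "(\<Sum>n. w (n + i)) \<le> c * (\<Sum>n. real n powr (- (1 + \<epsilon>))) * real i powr (- \<gamma>)"
proof -
  define z where "z n = real n powr (- (1 + \<epsilon>))" for n :: nat
  have z: "summable z" unfolding z_def using \<epsilon> by (simp add: summable_real_powr_iff)
  have zi: "summable (\<lambda>n. z (n + i))" using z by (subst summable_iff_shift)
  have le: "w (n + i) \<le> c * real i powr (- \<gamma>) * z (n + i)" for n
  proof -
    have "w (n + i) \<le> c * real (n + i) powr (- (1 + \<epsilon> + \<gamma>))" using i by (intro w) auto
    also have "\<dots> = c * (real (n + i) powr (- \<gamma>) * z (n + i))"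
      unfolding z_def by (simp flip: powr_add add: algebra_simps)
    also have "\<dots> \<le> c * (real i powr (- \<gamma>) * z (n + i))"
      using \<gamma> \<open>c \<ge> 0\<close> i by (intro mult_left_mono mult_right_mono powr_mono2') (auto simp: z_def)
    finally show ?thesis by (simp add: mult_ac)
  qed
  have s: "summable (\<lambda>n. w (n + i))"
    using le nn by (intro summable_comparison_test'[OF summable_mult[OF zi], of 0]) auto
  then show "summable w" by (subst (asm) summable_iff_shift)
  have "(\<Sum>n. w (n + i)) \<le> (\<Sum>n. c * real i powr (- \<gamma>) * z (n + i))"
    by (intro suminf_le le s summable_mult zi)
  also have "\<dots> = c * real i powr (- \<gamma>) * (\<Sum>n. z (n + i))" by (rule suminf_mult[OF zi])
  also have "\<dots> \<le> c * real i powr (- \<gamma>) * (\<Sum>n. z n)"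
    using suminf_split_initial_segment[OF z, of i] sum_nonneg[of "{..<i}" z] \<open>c \<ge> 0\<close>
    by (intro mult_left_mono) (simp_all add: z_def[abs_def])
  finally show "(\<Sum>n. w (n + i)) \<le> c * (\<Sum>n. real n powr (- (1 + \<epsilon>))) * real i powr (- \<gamma>)"
    by (simp add: z_def[abs_def] mult_ac)
qed

text \<open>A level \<open>k\<close> has mass \<open>w k - w (Suc k)\<close> and holding time
  \<open>k + 1\<close>. Summation by parts turns truncated moments into sums of tails, with a
  boundary term at the cutoff \<open>i\<close>.\<close>

lemma sum_by_parts_first_moment:
  fixes w :: "nat \<Rightarrow> real"
  shows "(\<Sum>k<i. (real k + 1) * (w k - w (Suc k))) = (\<Sum>k<i. w k) - real i * w i"
  by (induction i) (auto simp: algebra_simps)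

lemma sum_by_parts_second_moment:
  fixes w :: "nat \<Rightarrow> real"
  shows "(\<Sum>k<i. (real k + 1)\<^sup>2 * (w k - w (Suc k))) = (\<Sum>k<i. (2 * real k + 1) * w k) - (real i)\<^sup>2 * w i"
  by (induction i) (auto simp: algebra_simps power2_eq_square)

subsection \<open>Holding times of the walk\<close>

text \<open>Each column costs its entry level plus one step for leaving. The recursion makes the
  time total and measurable on all paths; it is the true arrival time in column \<open>x\<close> on
  paths that obey the transition rule.\<close>

primrec entry_time :: "(nat \<Rightarrow> 'a \<Rightarrow> nat \<times> nat) \<Rightarrow> nat \<Rightarrow> 'a \<Rightarrow> nat" where
  "entry_time Z 0 s = 0"
| "entry_time Z (Suc x) s = entry_time Z x s + snd (Z (entry_time Z x s) s) + 1"

definition entry_level :: "(nat \<Rightarrow> 'a \<Rightarrow> nat \<times> nat) \<Rightarrow> nat \<Rightarrow> 'a \<Rightarrow> nat" where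
  "entry_level Z x s = snd (Z (entry_time Z x s) s)"

lemma entry_time_eq_sum: "entry_time Z x s = (\<Sum>w<x. entry_level Z w s + 1)"
  by (induction x) (auto simp: entry_level_def)

locale stepping_walk = prob_space M
  for \<omega> :: "nat \<Rightarrow> nat \<Rightarrow> real" and M :: "'a measure" and Z :: "nat \<Rightarrow> 'a \<Rightarrow> nat \<times> nat" +
  assumes env: "environment \<omega>"
    and chain: "markov_chain M (init_prob \<omega>) (trans_prob \<omega>) Z"
begin

abbreviation "\<tau> \<equiv> entry_time Z"
abbreviation "Y \<equiv> entry_level Z"

lemma Z_measurable[measurable]: "Z n \<in> M \<rightarrow>\<^sub>M count_space UNIV"
  using chain unfolding markov_chain_def by blast

lemma entry_time_measurable[measurable]: "\<tau> x \<in> M \<rightarrow>\<^sub>M count_space UNIV"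
proof (induction x)
  case (Suc x)
  note Suc[measurable]
  have [measurable]: "(\<lambda>s. Z (\<tau> x s) s) \<in> M \<rightarrow>\<^sub>M count_space UNIV"
    by (rule measurable_compose_countable) simp_all
  show ?case by simp
qed simp

lemma entry_level_measurable[measurable]: "Y x \<in> M \<rightarrow>\<^sub>M count_space UNIV"
proof -
  have "(\<lambda>s. Z (\<tau> x s) s) \<in> M \<rightarrow>\<^sub>M count_space UNIV"
    by (rule measurable_compose_countable) simp_all
  from measurable_compose[OF this, of snd "count_space UNIV"] show ?thesis
    unfolding entry_level_def[abs_def] by simp
qed

section \<open>Paths that obey the transition rule\<close>

definition admissible :: "'a \<Rightarrow> bool" where
  "admissible s \<longleftrightarrow> fst (Z 0 s) = 0 \<and> (\<forall>n. trans_prob \<omega> (Z n s) (Z (Suc n) s) \<noteq> 0)"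

text \<open>The product form also covers segments of probability zero, where conditioning says
  nothing and both sides vanish.\<close>

lemma prob_path_step:
  "prob {s \<in> space M. (\<forall>i\<le>n. Z i s = zs i) \<and> Z (Suc n) s = z} =
   prob {s \<in> space M. \<forall>i\<le>n. Z i s = zs i} * trans_prob \<omega> (zs n) z"
proof (cases "prob {s \<in> space M. \<forall>i\<le>n. Z i s = zs i} > 0")
  case True
  then have "\<P>(s in M. Z (Suc n) s = z \<bar> \<forall>i\<le>n. Z i s = zs i) = trans_prob \<omega> (zs n) z"
    using chain unfolding markov_chain_def by blast
  then show ?thesis using True unfolding cond_prob_def by (simp add: field_simps conj_commute)
next
  case False
  then have 0: "prob {s \<in> space M. \<forall>i\<le>n. Z i s = zs i} = 0"
    by (simp add: zero_less_measure_iff)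
  have "prob {s \<in> space M. (\<forall>i\<le>n. Z i s = zs i) \<and> Z (Suc n) s = z}
      \<le> prob {s \<in> space M. \<forall>i\<le>n. Z i s = zs i}"
    by (rule finite_measure_mono) auto
  then show ?thesis using 0 by (simp add: measure_le_0_iff)
qed

text \<open>Every forbidden start or step is a null event by the initial law or
  \<open>prob_path_step\<close>, and countably many such events exhaust the violations.\<close>

lemma AE_admissible: "AE s in M. admissible s"
proof -
  have "AE s in M. Z 0 s \<noteq> z" if "fst z \<noteq> 0" for z
  proof -
    have "prob {s \<in> space M. Z 0 s = z} = 0"
      using chain that unfolding markov_chain_def init_prob_def by (cases z) simp
    then show ?thesis by (subst (asm) prob_eq_0) auto
  qed
  then have "AE s in M. \<forall>z. fst z \<noteq> 0 \<longrightarrow> Z 0 s \<noteq> z"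
    by (subst AE_all_countable) auto
  then have 0: "AE s in M. fst (Z 0 s) = 0" by eventually_elim blast
  have "AE s in M. \<forall>n. trans_prob \<omega> (Z n s) (Z (Suc n) s) \<noteq> 0"
    unfolding AE_all_countable
  proof
    fix n
    \<comment> \<open>Segments are taken as extensional functions on \<open>{..n}\<close>: the
      functions \<open>zs\<close> on all of the naturals are uncountably many.\<close>
    define G where "G = (PiE {..n} (\<lambda>_. UNIV) :: (nat \<Rightarrow> nat \<times> nat) set)"
    have G: "countable G" unfolding G_def by (intro countable_PiE) auto
    have "AE s in M. \<forall>zs\<in>G. \<forall>z. trans_prob \<omega> (zs n) z = 0 \<longrightarrow>
        \<not> ((\<forall>i\<le>n. Z i s = zs i) \<and> Z (Suc n) s = z)"
      unfolding AE_ball_countable[OF G] AE_all_countable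
    proof (intro ballI allI)
      fix zs z
      show "AE s in M. trans_prob \<omega> (zs n) z = 0 \<longrightarrow> \<not> ((\<forall>i\<le>n. Z i s = zs i) \<and> Z (Suc n) s = z)"
      proof (cases "trans_prob \<omega> (zs n) z = 0")
        case True
        then have "prob {s \<in> space M. (\<forall>i\<le>n. Z i s = zs i) \<and> Z (Suc n) s = z} = 0"
          using prob_path_step[of n zs z] by simp
        then have "AE s in M. \<not> ((\<forall>i\<le>n. Z i s = zs i) \<and> Z (Suc n) s = z)"
          by (subst (asm) prob_eq_0) auto
        then show ?thesis by eventually_elim auto
      qed auto
    qed
    then show "AE s in M. trans_prob \<omega> (Z n s) (Z (Suc n) s) \<noteq> 0"
    proof eventually_elim
      case (elim s)
      have "restrict (\<lambda>i. Z i s) {..n} \<in> G" by (simp add: G_def)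
      from bspec[OF elim this, rule_format, of "Z (Suc n) s"] show ?case by auto
    qed
  qed
  with 0 show ?thesis unfolding admissible_def by eventually_elim auto
qed

lemma admissible_step:
  assumes "admissible s"
  shows "Z n s = (x, Suc k) \<Longrightarrow> Z (Suc n) s = (x, k)"
    and "Z n s = (x, 0) \<Longrightarrow> fst (Z (Suc n) s) = Suc x"
  using assms[unfolded admissible_def, THEN conjunct2, rule_format, of n]
  by (auto simp: trans_prob_def split: prod.splits if_splits)

text \<open>Inside a column the level is forced down by one per step (\<open>run\<close>). Level 0
  is reached at time \<open>\<tau> x s + Y x s\<close>, and the next time,
  \<open>\<tau> (Suc x) s\<close>, is the entry to column \<open>x + 1\<close>.\<close>

lemma admissible_path:
  assumes s: "admissible s"
  shows "j \<le> Y x s \<Longrightarrow> Z (\<tau> x s + j) s = (x, Y x s - j)"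
proof (induction x arbitrary: j)
  have run: "j \<le> Y x s \<Longrightarrow> Z (\<tau> x s + j) s = (x, Y x s - j)" if "fst (Z (\<tau> x s) s) = x" for x j
  proof (induction j)
    case 0
    then show ?case using that by (simp add: entry_level_def prod_eq_iff)
  next
    case (Suc j)
    then have "Z (\<tau> x s + j) s = (x, Suc (Y x s - Suc j))" by (simp add: Suc_diff_Suc)
    from admissible_step(1)[OF s this] show ?case by simp
  qed
  {
    case 0
    then show ?case using run[of 0] s by (simp add: admissible_def)
  next
    case (Suc x)
    have "Z (\<tau> x s + Y x s) s = (x, 0)" using Suc.IH[of "Y x s"] by simp
    from admissible_step(2)[OF s this] have "fst (Z (\<tau> (Suc x) s) s) = Suc x"
      by (simp add: entry_level_def)
    then show ?case using run Suc.prems by blast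
  }
qed

text \<open>By the recursion for \<open>\<tau>\<close>, blocks of length \<open>Y w s + 1\<close>
  tile the times before \<open>\<tau> x s\<close>, on every path.\<close>

lemma time_decomp:
  "n < \<tau> x s \<Longrightarrow> \<exists>w<x. \<exists>j\<le>Y w s. n = \<tau> w s + j"
proof (induction x)
  case (Suc x)
  show ?case
  proof (cases "n < \<tau> x s")
    case True
    then show ?thesis using Suc.IH less_SucI by blast
  next
    case False
    then have "n = \<tau> x s + (n - \<tau> x s)" "n - \<tau> x s \<le> Y x s"
      using Suc.prems by (auto simp: entry_level_def)
    then show ?thesis by blast
  qed
qed simp

lemma less_entry_time: "n < \<tau> (Suc n) s"
  by (induction n) (auto intro: le_less_trans)

text \<open>These are the inequalities that \<open>LIMSEQ_inverse_count\<close> requires when the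
  position of the walk is the counting function.\<close>

lemma position_bounds:
  assumes s: "admissible s"
  shows "\<tau> (fst (Z n s)) s \<le> n" "n < \<tau> (Suc (fst (Z n s))) s"
proof -
  obtain w j where w: "j \<le> Y w s" "n = \<tau> w s + j"
    using time_decomp[OF less_entry_time[of n s]] by blast
  then have "fst (Z n s) = w" using admissible_path[OF s, of j w] by simp
  then show "\<tau> (fst (Z n s)) s \<le> n" "n < \<tau> (Suc (fst (Z n s))) s"
    using w by (auto simp: entry_level_def)
qed

text \<open>The levels \<open>y 0, \<dots>, y (x - 1)\<close> determine an admissible path up to the last step before the
  entry to \<open>x\<close>, so that the event is almost surely a cylinder event of the chain.\<close>
lemma prob_entry_level_history:
  "prob {s \<in> space M. (\<forall>w<x. Y w s = y w) \<and> Y x s = k} =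
   prob {s \<in> space M. \<forall>w<x. Y w s = y w} * (\<omega> x k - \<omega> x (Suc k))"
proof (cases x)
  case 0
  have "prob {s \<in> space M. Y 0 s = k} = prob {s \<in> space M. Z 0 s = (0, k)}"
    by (rule finite_measure_eq_AE)
      (use AE_admissible in \<open>auto elim!: eventually_mono simp: admissible_def entry_level_def prod_eq_iff\<close>)
  also have "\<dots> = \<omega> 0 k - \<omega> 0 (Suc k)"
    using chain unfolding markov_chain_def init_prob_def by auto
  finally show ?thesis using 0 by (simp add: prob_space)
next
  case (Suc x')
  show ?thesis
  proof (cases "\<exists>s\<in>space M. admissible s \<and> (\<forall>w<x. Y w s = y w)")
    \<comment> \<open>Almost every path is admissible, so here the history is a null event and both
      sides vanish.\<close>
    case False
    have ae: "AE s in M. \<not> (\<forall>w<x. Y w s = y w)"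
      using AE_admissible AE_space by eventually_elim (use False in blast)
    then have "AE s in M. \<not> ((\<forall>w<x. Y w s = y w) \<and> Y x s = k)"
      by eventually_elim auto
    then have "prob {s \<in> space M. (\<forall>w<x. Y w s = y w) \<and> Y x s = k} = 0"
      by (subst prob_eq_0) auto
    moreover have "prob {s \<in> space M. \<forall>w<x. Y w s = y w} = 0"
      using ae by (subst prob_eq_0) auto
    ultimately show ?thesis by simp
  next
    case True
    \<comment> \<open>All admissible paths with these levels visit the same states up to time
      \<open>t\<close>, the last moment in column \<open>x'\<close>; the witness \<open>s0\<close>
      supplies these states.\<close>
    then obtain s0 where s0: "admissible s0" "\<And>w. w < x \<Longrightarrow> Y w s0 = y w" by blast
    define t where "t = \<tau> x s0 - 1"
    have t: "\<tau> x s0 = Suc t" using Suc by (simp add: t_def)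
    define zs where "zs i = Z i s0" for i
    have zt: "zs t = (x', 0)"
      using admissible_path[OF s0(1), of "Y x' s0" x'] Suc t by (simp add: zs_def entry_level_def)
    have path: "(\<forall>w<x. Y w s = y w) \<longleftrightarrow> (\<forall>i\<le>t. Z i s = zs i)" if s: "admissible s" for s
    proof
      assume Ys: "\<forall>w<x. Y w s = y w"
      have eq: "\<tau> w s = \<tau> w s0" if "w \<le> x" for w
        unfolding entry_time_eq_sum using that Ys s0 by (intro sum.cong) auto
      show "\<forall>i\<le>t. Z i s = zs i"
      proof (intro allI impI)
        fix i assume "i \<le> t"
        then obtain w j where w: "w < x" "j \<le> Y w s0" "i = \<tau> w s0 + j"
          using time_decomp[of i x s0] t by auto
        then have "j \<le> Y w s" "i = \<tau> w s + j" using Ys s0(2) eq by auto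
        then show "Z i s = zs i"
          using admissible_path[OF s, of j w] admissible_path[OF s0(1) w(2)] w Ys s0(2) by (auto simp: zs_def)
      qed
    next
      \<comment> \<open>Strong induction on the column: earlier levels fix
        \<open>\<tau> w s\<close>, this time is at most \<open>t\<close> for \<open>w < x\<close>,
        and the state there reveals the level of column \<open>w\<close>.\<close>
      assume Zs: "\<forall>i\<le>t. Z i s = zs i"
      have "\<tau> w s = \<tau> w s0 \<and> (w < x \<longrightarrow> Y w s = y w)" if "w \<le> x" for w
        using that
      proof (induction w rule: less_induct)
        case (less w)
        then have eq: "\<tau> w s = \<tau> w s0"
          unfolding entry_time_eq_sum using s0(2) by (intro sum.cong) auto
        have "Y w s = y w" if "w < x"
        proof -
          have "\<tau> (Suc w) s0 \<le> \<tau> x s0" unfolding entry_time_eq_sum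
            using that by (intro sum_mono2) auto
          then have "\<tau> w s0 \<le> t" using t by simp
          then have "Y w s = Y w s0" using Zs eq by (simp add: entry_level_def zs_def)
          then show ?thesis using s0(2) that by simp
        qed
        with eq show ?case by blast
      qed
      then show "\<forall>w<x. Y w s = y w" by auto
    qed
    have entry: "Y x s = k \<longleftrightarrow> Z (Suc t) s = (x, k)"
      if s: "admissible s" and Ys: "\<forall>w<x. Y w s = y w" for s
    proof -
      have "\<tau> x s = Suc t"
        unfolding t[symmetric] entry_time_eq_sum using Ys s0 by (intro sum.cong) auto
      then show ?thesis using admissible_path[OF s, of 0 x] by auto
    qed
    have "prob {s \<in> space M. (\<forall>w<x. Y w s = y w) \<and> Y x s = k} =
        prob {s \<in> space M. (\<forall>i\<le>t. Z i s = zs i) \<and> Z (Suc t) s = (x, k)}"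
    proof (rule finite_measure_eq_AE)
      have "(\<forall>w<x. Y w s = y w) \<and> Y x s = k \<longleftrightarrow> (\<forall>i\<le>t. Z i s = zs i) \<and> Z (Suc t) s = (x, k)"
        if "admissible s" for s
        using path[OF that] entry[OF that] by blast
      then show "AE s in M. (s \<in> {s \<in> space M. (\<forall>w<x. Y w s = y w) \<and> Y x s = k}) =
          (s \<in> {s \<in> space M. (\<forall>i\<le>t. Z i s = zs i) \<and> Z (Suc t) s = (x, k)})"
        by (intro eventually_mono[OF AE_admissible]) blast
    qed measurable
    also have "\<dots> = prob {s \<in> space M. \<forall>i\<le>t. Z i s = zs i} * (\<omega> x k - \<omega> x (Suc k))"
      using prob_path_step[of t zs "(x, k)"] Suc by (simp add: zt trans_prob_def)
    also have "prob {s \<in> space M. \<forall>i\<le>t. Z i s = zs i} = prob {s \<in> space M. \<forall>w<x. Y w s = y w}"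
      by (rule finite_measure_eq_AE)
        (use AE_admissible path in \<open>auto elim!: eventually_mono\<close>)
    finally show ?thesis .
  qed
qed

section \<open>Marginal laws and pairwise independence of the entry levels\<close>

lemma level_prob_nonneg: "0 \<le> \<omega> x k - \<omega> x (Suc k)"
  using env unfolding environment_def by (simp add: less_imp_le)

text \<open>An event that depends only on the levels before \<open>x\<close> is a countable disjoint
  union of complete histories, over which \<open>prob_entry_level_history\<close> is summed. A
  trivial \<open>Q\<close> gives the law of one level, and a \<open>Q\<close> that fixes an earlier
  level gives pairwise independence.\<close>

lemma prob_entry_level_past:
  assumes Q: "\<And>h h'. (\<And>w. w < x \<Longrightarrow> h w = h' w) \<Longrightarrow> Q h = Q h'"
    and [measurable]: "Measurable.pred M (\<lambda>s. Q (\<lambda>w. Y w s))"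
  shows "prob {s \<in> space M. Q (\<lambda>w. Y w s) \<and> Y x s = k} =
    prob {s \<in> space M. Q (\<lambda>w. Y w s)} * (\<omega> x k - \<omega> x (Suc k))"
proof -
  define G where "G = {h \<in> PiE {..<x} (\<lambda>_. UNIV :: nat set). Q h}"
  have G: "countable G" unfolding G_def
    by (rule countable_subset[of _ "PiE {..<x} (\<lambda>_. UNIV)"]) (auto intro!: countable_PiE)
  define H where "H h = {s \<in> space M. \<forall>w<x. Y w s = h w}" for h
  define K where "K h = {s \<in> space M. (\<forall>w<x. Y w s = h w) \<and> Y x s = k}" for h
  have cover: "\<exists>h\<in>G. \<forall>w<x. Y w s = h w" if "Q (\<lambda>w. Y w s)" for s
    using that Q[of "\<lambda>w. Y w s" "restrict (\<lambda>w. Y w s) {..<x}"]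
    by (intro bexI[of _ "restrict (\<lambda>w. Y w s) {..<x}"]) (auto simp: G_def)
  have Q_of_G: "Q (\<lambda>w. Y w s)" if "h \<in> G" "\<forall>w<x. Y w s = h w" for s h
    using that Q[of "\<lambda>w. Y w s" h] by (auto simp: G_def)
  have disj: "h = h'" if "h \<in> G" "h' \<in> G" "\<forall>w<x. y w = h w" "\<forall>w<x. y w = h' w" for h h' :: "nat \<Rightarrow> nat" and y
    using that unfolding G_def by (auto intro!: PiE_ext[of h "{..<x}" _ h'])
  have Q_iff: "Q (\<lambda>w. Y w s) \<longleftrightarrow> (\<exists>h\<in>G. \<forall>w<x. Y w s = h w)" for s
    using cover Q_of_G by blast
  have Heq: "{s \<in> space M. Q (\<lambda>w. Y w s)} = (\<Union>h\<in>G. H h)"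
    unfolding H_def Q_iff by blast
  have Keq: "{s \<in> space M. Q (\<lambda>w. Y w s) \<and> Y x s = k} = (\<Union>h\<in>G. K h)"
    unfolding K_def Q_iff by blast
  have dH: "disjoint_family_on H G"
    unfolding disjoint_family_on_def
  proof (intro ballI impI equals0I)
    fix h h' s assume "h \<in> G" "h' \<in> G" "h \<noteq> h'" "s \<in> H h \<inter> H h'"
    then show False using disj[of h h' "\<lambda>w. Y w s"] unfolding H_def by blast
  qed
  have dK: "disjoint_family_on K G"
    by (rule disjoint_family_on_bisimulation[OF dH]) (auto simp: H_def K_def)
  have [measurable]: "H h \<in> sets M" "K h \<in> sets M" for h unfolding H_def K_def by measurable
  let ?p = "\<omega> x k - \<omega> x (Suc k)"
  \<comment> \<open>The sum over histories is an integral over the counting measure on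
    \<open>G\<close>, with values in \<open>ennreal\<close>, so that no summability has to be
    checked.\<close>
  have "emeasure M (\<Union>h\<in>G. K h) = (\<integral>\<^sup>+ h. emeasure M (K h) \<partial>count_space G)"
    by (intro emeasure_UN_countable G dK) auto
  also have "\<dots> = (\<integral>\<^sup>+ h. ennreal ?p * emeasure M (H h) \<partial>count_space G)"
    unfolding K_def H_def emeasure_eq_measure prob_entry_level_history
    using level_prob_nonneg by (simp add: ennreal_mult mult.commute)
  also have "\<dots> = ennreal ?p * (\<integral>\<^sup>+ h. emeasure M (H h) \<partial>count_space G)"
    by (rule nn_integral_cmult) simp
  also have "(\<integral>\<^sup>+ h. emeasure M (H h) \<partial>count_space G) = emeasure M (\<Union>h\<in>G. H h)"
    by (intro emeasure_UN_countable[symmetric] G dH) auto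
  finally show ?thesis
    unfolding Heq Keq emeasure_eq_measure using level_prob_nonneg
    by (simp add: mult.commute flip: ennreal_mult)
qed

lemma prob_entry_level: "prob {s \<in> space M. Y x s = k} = \<omega> x k - \<omega> x (Suc k)"
  using prob_entry_level_past[of x "\<lambda>_. True" k] by (simp add: prob_space)

lemma prob_entry_level_pair:
  assumes "x \<noteq> x'"
  shows "prob {s \<in> space M. Y x s = k \<and> Y x' s = k'} =
    prob {s \<in> space M. Y x s = k} * prob {s \<in> space M. Y x' s = k'}"
proof -
  have *: "prob {s \<in> space M. Y a s = j \<and> Y b s = j'} =
    prob {s \<in> space M. Y a s = j} * prob {s \<in> space M. Y b s = j'}" if "a < b" for a b j j'
    using prob_entry_level_past[of b "\<lambda>h. h a = j" j'] that by (simp add: prob_entry_level)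
  show ?thesis
    using assms *[of x x' k k'] *[of x' x k' k] by (cases x x' rule: linorder_cases) (auto simp: conj_commute)
qed

lemma prob_entry_level_ge: "prob {s \<in> space M. k \<le> Y x s} = \<omega> x k"
proof (induction k)
  case 0
  then show ?case using env by (simp add: prob_space environment_def)
next
  case (Suc k)
  have "prob {s \<in> space M. k \<le> Y x s} = prob ({s \<in> space M. Suc k \<le> Y x s} \<union> {s \<in> space M. Y x s = k})"
    by (rule arg_cong[where f = prob]) auto
  also have "\<dots> = prob {s \<in> space M. Suc k \<le> Y x s} + prob {s \<in> space M. Y x s = k}"
    by (rule finite_measure_Union) auto
  finally show ?case using Suc by (simp add: prob_entry_level)
qed

section \<open>Truncated holding times and their moments\<close>

definition truncated_time :: "nat \<Rightarrow> 'a \<Rightarrow> real" where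
  "truncated_time i s = (if Y i s < i then real (Y i s) + 1 else 0)"

text \<open>Finite combinations of level indicators reduce every moment to level probabilities. The
  exponent is positive because the value 0 beyond the cutoff would otherwise become 1.\<close>

lemma truncated_time_power:
  assumes "0 < r"
  shows "truncated_time i s ^ r = (\<Sum>k<i. (real k + 1) ^ r * indicator {s. Y i s = k} s)"
proof -
  have "(\<Sum>k<i. (real k + 1) ^ r * indicator {s. Y i s = k} s) =
    (\<Sum>k<i. if k = Y i s then (real (Y i s) + 1) ^ r else 0)"
    by (intro sum.cong) (auto simp: indicator_def)
  then show ?thesis using assms by (simp add: truncated_time_def sum.delta)
qed

lemma integrable_level_indicator:
  "integrable M (\<lambda>s. c * indicator {s. Y i s = k} s :: real)"
  "integrable M (\<lambda>s. c * (indicator {s. Y i s = k} s * indicator {s. Y j s = k'} s) :: real)"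
proof -
  have "integrable M (\<lambda>s. indicator {s. Y i s = k} s :: real)"
    "integrable M (\<lambda>s. indicator {s. Y i s = k} s * indicator {s. Y j s = k'} s :: real)"
    by (auto intro!: integrable_const_bound[where B = 1] simp: indicator_def)
  then show "integrable M (\<lambda>s. c * indicator {s. Y i s = k} s :: real)"
    "integrable M (\<lambda>s. c * (indicator {s. Y i s = k} s * indicator {s. Y j s = k'} s) :: real)"
    by (auto intro: integrable_mult_right)
qed

lemma expectation_level_indicator:
  "expectation (\<lambda>s. c * indicator {s. Y i s = k} s) = c * prob {s \<in> space M. Y i s = k}"
  "expectation (\<lambda>s. c * (indicator {s. Y i s = k} s * indicator {s. Y j s = k'} s)) =
    c * prob {s \<in> space M. Y i s = k \<and> Y j s = k'}"
proof -
  have "expectation (\<lambda>s. indicator {s. Y i s = k} s :: real) = prob {s \<in> space M. Y i s = k}"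
    by (simp add: Int_def conj_commute)
  moreover have "expectation (\<lambda>s. indicator {s. Y i s = k} s * indicator {s. Y j s = k'} s :: real) =
      expectation (\<lambda>s. indicator {s. Y i s = k \<and> Y j s = k'} s :: real)"
    by (intro Bochner_Integration.integral_cong) (auto simp: indicator_def)
  moreover have "\<dots> = prob {s \<in> space M. Y i s = k \<and> Y j s = k'}"
    by (simp add: Int_def conj_ac)
  ultimately show "expectation (\<lambda>s. c * indicator {s. Y i s = k} s) = c * prob {s \<in> space M. Y i s = k}"
    "expectation (\<lambda>s. c * (indicator {s. Y i s = k} s * indicator {s. Y j s = k'} s)) =
    c * prob {s \<in> space M. Y i s = k \<and> Y j s = k'}" by simp_all
qed

lemma truncated_time_moment:
  assumes "0 < r"
  shows "integrable M (\<lambda>s. truncated_time i s ^ r)"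
    "expectation (\<lambda>s. truncated_time i s ^ r) = (\<Sum>k<i. (real k + 1) ^ r * (\<omega> i k - \<omega> i (Suc k)))"
proof -
  show "integrable M (\<lambda>s. truncated_time i s ^ r)"
    unfolding truncated_time_power[OF assms]
    by (intro Bochner_Integration.integrable_sum integrable_level_indicator)
  have "expectation (\<lambda>s. truncated_time i s ^ r) =
      (\<Sum>k<i. expectation (\<lambda>s. (real k + 1) ^ r * indicator {s. Y i s = k} s))"
    unfolding truncated_time_power[OF assms]
    by (intro Bochner_Integration.integral_sum integrable_level_indicator)
  then show "expectation (\<lambda>s. truncated_time i s ^ r) = (\<Sum>k<i. (real k + 1) ^ r * (\<omega> i k - \<omega> i (Suc k)))"
    unfolding expectation_level_indicator prob_entry_level .
qed

lemma truncated_time_product: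
  "truncated_time i s * truncated_time j s = (\<Sum>k<i. \<Sum>k'<j. (real k + 1) * (real k' + 1) *
    (indicator {s. Y i s = k} s * indicator {s. Y j s = k'} s))"
proof -
  have eq: "truncated_time i s = (\<Sum>k<i. (real k + 1) * indicator {s. Y i s = k} s)" for i
    using truncated_time_power[of 1 i s] unfolding power_one_right by simp
  show ?thesis unfolding eq sum_product by (intro sum.cong refl) (simp only: mult_ac)
qed

lemma integrable_truncated_time_product:
  "integrable M (\<lambda>s. truncated_time i s * truncated_time j s)"
  unfolding truncated_time_product by (intro Bochner_Integration.integrable_sum integrable_level_indicator)

lemma truncated_time_uncorrelated:
  assumes "i \<noteq> j"
  shows "expectation (\<lambda>s. truncated_time i s * truncated_time j s) =
    expectation (truncated_time i) * expectation (truncated_time j)"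
proof -
  have "expectation (\<lambda>s. truncated_time i s * truncated_time j s) =
    (\<Sum>k<i. \<Sum>k'<j. expectation (\<lambda>s. (real k + 1) * (real k' + 1) *
      (indicator {s. Y i s = k} s * indicator {s. Y j s = k'} s)))"
    unfolding truncated_time_product
    by (subst Bochner_Integration.integral_sum
        | intro Bochner_Integration.integrable_sum integrable_level_indicator sum.cong refl)+
  also have "\<dots> = (\<Sum>k<i. \<Sum>k'<j. ((real k + 1) * (\<omega> i k - \<omega> i (Suc k))) *
      ((real k' + 1) * (\<omega> j k' - \<omega> j (Suc k'))))"
    unfolding expectation_level_indicator prob_entry_level_pair[OF assms] prob_entry_level
    by (simp only: mult_ac)
  finally show ?thesis
    using truncated_time_moment(2)[of 1 i] truncated_time_moment(2)[of 1 j]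
    by (simp add: sum_product)
qed

section \<open>Law of large numbers for the entry times\<close>

lemma AE_truncated_time_eq:
  assumes "summable (\<lambda>i. \<omega> i i)"
  shows "AE s in M. \<forall>\<^sub>F i in sequentially. truncated_time i s = real (Y i s) + 1"
proof -
  \<comment> \<open>Truncation changes the holding time of column \<open>i\<close> exactly when
    \<open>i \<le> Y i s\<close>, an event of probability \<open>\<omega> i i\<close>;
    Borel-Cantelli applies.\<close>
  have "AE s in M. \<forall>\<^sub>F i in sequentially. s \<in> space M - {s \<in> space M. i \<le> Y i s}"
    using assms by (intro borel_cantelli_AE1) (auto simp: prob_entry_level_ge less_top[symmetric])
  then show ?thesis
    by eventually_elim (auto elim!: eventually_mono simp: truncated_time_def)
qed

text \<open>In the tail exponent, \<open>1 + \<epsilon>\<close> secures convergent series, while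
  \<gamma> outweighs the growth \<open>i powr l\<close> of the constants; the surplus is
  \<open>\<delta> = \<gamma> - l\<close>.\<close>

lemma AE_entry_time_LIMSEQ:
  assumes tail: "\<And>i n. i \<ge> 1 \<Longrightarrow> n \<ge> 1 \<Longrightarrow> \<omega> i n \<le> C * real i powr l * real n powr (- (1 + \<epsilon> + \<gamma>))"
    and C: "C \<ge> 0" and \<epsilon>: "\<epsilon> > 0" and l: "0 \<le> l" "l < \<gamma>" and \<gamma>: "\<gamma> < 1"
    and mean: "(\<lambda>x. (\<Sum>w<x. mean_time \<omega> w) / real x) \<longlonglongrightarrow> \<mu>"
  shows "AE s in M. (\<lambda>x. real (\<tau> x s) / real x) \<longlonglongrightarrow> \<mu>"
proof -
  define \<delta> where "\<delta> = \<gamma> - l"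
  have \<delta>: "0 < \<delta>" "\<delta> < 1" using l \<gamma> by (auto simp: \<delta>_def)
  define \<zeta> where "\<zeta> = (\<Sum>n. real n powr (- (1 + \<epsilon>)))"
  have \<zeta>: "0 \<le> \<zeta>" unfolding \<zeta>_def using \<epsilon> by (intro suminf_nonneg) (auto simp: summable_real_powr_iff)
  have \<omega>0: "\<omega> i 0 = 1" and \<omega>_nonneg: "0 \<le> \<omega> i n" for i n
    using env unfolding environment_def by (auto, cases n, auto simp: less_imp_le)
  have first: "expectation (truncated_time i) = (\<Sum>k<i. \<omega> i k) - real i * \<omega> i i" for i
    using truncated_time_moment(2)[of 1 i] by (simp add: sum_by_parts_first_moment)
  \<comment> \<open>The loss in the mean is the tail sum from \<open>i\<close> on plus the boundary
    term \<open>i * \<omega> i i\<close>; both are of order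
    \<open>i powr (- \<delta>)\<close>.\<close>
  have deficit: "0 \<le> mean_time \<omega> i - expectation (truncated_time i)"
    "mean_time \<omega> i - expectation (truncated_time i) \<le> (C * \<zeta> + C) * real i powr (- \<delta>)" if i: "i \<ge> 1" for i
  proof -
    note bnd = tail_sum_bound[of "\<omega> i" "C * real i powr l" \<epsilon> \<gamma> i, folded \<zeta>_def]
    have sm: "summable (\<omega> i)" and ts: "(\<Sum>n. \<omega> i (n + i)) \<le> C * real i powr l * \<zeta> * real i powr (- \<gamma>)"
      using tail[OF i] \<omega>_nonneg C \<epsilon> l i by (auto intro!: bnd)
    have eq: "mean_time \<omega> i - expectation (truncated_time i) = (\<Sum>n. \<omega> i (n + i)) + real i * \<omega> i i"
      unfolding first mean_time_def using suminf_split_initial_segment[OF sm, of i] by simp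
    have "0 \<le> (\<Sum>n. \<omega> i (n + i))"
      using sm \<omega>_nonneg by (intro suminf_nonneg) (auto simp: summable_iff_shift)
    then show "0 \<le> mean_time \<omega> i - expectation (truncated_time i)"
      unfolding eq using \<omega>_nonneg by simp
    have "real i * \<omega> i i \<le> real i * (C * real i powr l * real i powr (- (1 + \<epsilon> + \<gamma>)))"
      by (intro mult_left_mono tail i) auto
    also have "\<dots> = C * (real i powr 1 * real i powr l * real i powr (- (1 + \<epsilon> + \<gamma>)))"
      using i by simp
    also have "\<dots> = C * real i powr (- \<epsilon> - \<delta>)"
      unfolding powr_add[symmetric] by (simp add: \<delta>_def algebra_simps)
    also have "\<dots> \<le> C * real i powr (- \<delta>)"
      using i C \<epsilon> by (intro mult_left_mono powr_mono) auto
    finally have b: "real i * \<omega> i i \<le> C * real i powr (- \<delta>)" .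
    note ts
    also have "C * real i powr l * \<zeta> * real i powr (- \<gamma>) = C * \<zeta> * (real i powr l * real i powr (- \<gamma>))"
      by simp
    also have "\<dots> = C * \<zeta> * real i powr (- \<delta>)"
      unfolding powr_add[symmetric] by (simp add: \<delta>_def)
    finally show "mean_time \<omega> i - expectation (truncated_time i) \<le> (C * \<zeta> + C) * real i powr (- \<delta>)"
      unfolding eq using b by (simp add: algebra_simps)
  qed
  have "(\<lambda>i. mean_time \<omega> i - expectation (truncated_time i)) \<longlonglongrightarrow> 0"
  proof (rule tendsto_sandwich[OF _ _ tendsto_const])
    have "(\<lambda>i. (C * \<zeta> + C) * real i powr (- \<delta>)) \<longlonglongrightarrow> (C * \<zeta> + C) * 0"
      using \<delta> by (intro tendsto_mult tendsto_const tendsto_neg_powr filterlim_real_sequentially) auto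
    then show "(\<lambda>i. (C * \<zeta> + C) * real i powr (- \<delta>)) \<longlonglongrightarrow> 0" by simp
  qed (use deficit in \<open>auto intro!: eventually_sequentiallyI[of 1]\<close>)
  from LIMSEQ_cesaro_null[OF this] mean
  have "(\<lambda>n. (\<Sum>w<n. mean_time \<omega> w) / real n -
      (\<Sum>i<n. mean_time \<omega> i - expectation (truncated_time i)) / real n) \<longlonglongrightarrow> \<mu> - 0"
    by (intro tendsto_diff)
  then have tmean: "(\<lambda>n. (\<Sum>i<n. expectation (truncated_time i)) / real n) \<longlonglongrightarrow> \<mu>"
    by (simp add: sum_subtractf diff_divide_distrib)
  \<comment> \<open>The summand 1 stands for \<open>\<omega> i 0\<close>, which is at most
    \<open>i powr (1 - \<delta>)\<close> for \<open>i \<ge> 1\<close>; the rest comes from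
    \<open>weighted_tail_sum_bound\<close>.\<close>
  define K where "K = 1 + 3 * C * \<zeta>"
  have K: "0 \<le> K" using C \<zeta> by (simp add: K_def)
  \<comment> \<open>A bound uniform over \<open>i < n\<close> suffices: adding \<open>n\<close>
    copies of it gives the exponent \<open>2 - \<delta>\<close> of the strong law.\<close>
  have second: "expectation (\<lambda>s. (truncated_time i s)\<^sup>2) \<le> K * real n powr (1 - \<delta>)" if "i < n" for i n
  proof (cases "i = 0")
    case True
    then show ?thesis using truncated_time_moment(2)[of 2 0] K by simp
  next
    case False
    then have i: "1 \<le> i" by simp
    have "expectation (\<lambda>s. (truncated_time i s)\<^sup>2) = (\<Sum>k<i. (2 * real k + 1) * \<omega> i k) - (real i)\<^sup>2 * \<omega> i i"
      using truncated_time_moment(2)[of 2 i] by (simp add: sum_by_parts_second_moment)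
    also have "\<dots> \<le> (\<Sum>k<i. (2 * real k + 1) * \<omega> i k)" using \<omega>_nonneg by simp
    also have "\<dots> \<le> \<bar>\<omega> i 0\<bar> + 3 * (C * real i powr l) * \<zeta> * real i powr (1 - \<gamma>)"
      unfolding \<zeta>_def using tail[OF i] C \<epsilon> \<gamma> by (intro weighted_tail_sum_bound) auto
    also have "\<dots> = 1 + 3 * C * \<zeta> * (real i powr l * real i powr (1 - \<gamma>))" by (simp add: \<omega>0)
    also have "\<dots> = 1 + 3 * C * \<zeta> * real i powr (1 - \<delta>)"
      unfolding powr_add[symmetric] by (simp add: \<delta>_def algebra_simps)
    also have "\<dots> \<le> real i powr (1 - \<delta>) + 3 * C * \<zeta> * real i powr (1 - \<delta>)"
      using i \<delta> by (intro add_right_mono ge_one_powr_ge_zero) auto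
    also have "\<dots> = K * real i powr (1 - \<delta>)" by (simp add: K_def algebra_simps)
    also have "\<dots> \<le> K * real n powr (1 - \<delta>)"
      using \<delta> K that by (intro mult_left_mono powr_mono2) auto
    finally show ?thesis .
  qed
  have "AE s in M. (\<lambda>n. (\<Sum>i<n. truncated_time i s) / real n) \<longlonglongrightarrow> \<mu>"
  proof (rule strong_law_uncorrelated_nonneg)
    show "(\<Sum>i<n. expectation (\<lambda>s. (truncated_time i s)\<^sup>2)) \<le> K * real n powr (2 - \<delta>)" for n
    proof -
      have "(\<Sum>i<n. expectation (\<lambda>s. (truncated_time i s)\<^sup>2)) \<le> (\<Sum>i<n. K * real n powr (1 - \<delta>))"
        by (intro sum_mono second) simp
      also have "\<dots> = K * (real n powr 1 * real n powr (1 - \<delta>))" by simp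
      also have "\<dots> = K * real n powr (2 - \<delta>)" unfolding powr_add[symmetric] by simp
      finally show ?thesis .
    qed
    show "0 \<le> truncated_time i s" for i s by (simp add: truncated_time_def)
  qed (use \<delta> tmean truncated_time_moment(1)[of 1] integrable_truncated_time_product
      truncated_time_uncorrelated in simp_all)
  moreover have "AE s in M. \<forall>\<^sub>F i in sequentially. truncated_time i s = real (Y i s) + 1"
  proof (rule AE_truncated_time_eq, rule summable_comparison_test'[where N = 1])
    show "summable (\<lambda>i. C * real i powr (- (1 + \<epsilon> + \<delta>)))"
      using \<epsilon> \<delta> by (intro summable_mult) (simp add: summable_real_powr_iff)
    fix i :: nat assume i: "1 \<le> i"
    have "\<omega> i i \<le> C * (real i powr l * real i powr (- (1 + \<epsilon> + \<gamma>)))"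
      using tail[OF i i] by (simp add: mult_ac)
    also have "\<dots> = C * real i powr (- (1 + \<epsilon> + \<delta>))"
      unfolding powr_add[symmetric] by (simp add: \<delta>_def algebra_simps)
    finally show "norm (\<omega> i i) \<le> C * real i powr (- (1 + \<epsilon> + \<delta>))" using \<omega>_nonneg by simp
  qed
  ultimately show ?thesis
  proof eventually_elim
    case (elim s)
    \<comment> \<open>The truncation error is eventually 0 along the path, so its averages
      vanish.\<close>
    have "(\<lambda>i. real (Y i s) + 1 - truncated_time i s) \<longlonglongrightarrow> 0"
      by (rule tendsto_eventually) (use elim(2) in \<open>auto elim!: eventually_mono\<close>)
    from tendsto_add[OF LIMSEQ_cesaro_null[OF this] elim(1)]
    show ?case by (simp add: entry_time_eq_sum sum_subtractf add.commute flip: add_divide_distrib)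
  qed
qed

lemma AE_walk_speed:
  assumes "AE s in M. (\<lambda>x. real (\<tau> x s) / real x) \<longlonglongrightarrow> \<mu>" and "\<mu> > 0"
  shows "AE s in M. (\<lambda>n. inverse (real n) * real (fst (Z n s))) \<longlonglongrightarrow> inverse \<mu>"
  using assms(1) AE_admissible
  by eventually_elim (rule LIMSEQ_inverse_count[OF _ assms(2) position_bounds])

end

section \<open>A common tail exponent for all columns, and the speed\<close>

lemma environment_tail_bound:
  assumes "\<And>x. \<beta> x > 1" and b: "b \<le> (INF x. \<beta> x)"
    and C: "\<forall>x\<ge>1. tail_const \<beta> \<omega> x \<le> ereal (C * real x powr l)"
    and "x \<ge> 1" "n \<ge> 1"
  shows "\<omega> x n \<le> max C 0 * real x powr l * real n powr (- b)"
proof -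
  have b\<beta>: "b \<le> \<beta> x"
    using assms(1) by (intro order_trans[OF b] cINF_lower bdd_belowI2[of _ 1]) (auto simp: less_imp_le)
  have "ereal (real n powr \<beta> x * \<omega> x n) \<le> (SUP n\<in>{1..}. ereal (real n powr \<beta> x * \<omega> x n))"
    using assms(5) by (intro SUP_upper) auto
  also have "\<dots> \<le> tail_const \<beta> \<omega> x" by (simp add: tail_const_def)
  also have "\<dots> \<le> ereal (C * real x powr l)" using C assms(4) by blast
  finally have "real n powr \<beta> x * \<omega> x n \<le> C * real x powr l" by simp
  \<comment> \<open>This provides the nonnegative constant that \<open>AE_entry_time_LIMSEQ\<close>
    asks for.\<close>
  also have "\<dots> \<le> max C 0 * real x powr l" by (intro mult_right_mono) auto
  finally have "real n powr (- \<beta> x) * (real n powr \<beta> x * \<omega> x n)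
      \<le> real n powr (- \<beta> x) * (max C 0 * real x powr l)"
    by (intro mult_left_mono) auto
  moreover have "real n powr (- \<beta> x) * (real n powr \<beta> x * \<omega> x n) = \<omega> x n"
    unfolding mult.assoc[symmetric] powr_add[symmetric] using assms(5) by simp
  ultimately have "\<omega> x n \<le> real n powr (- \<beta> x) * (max C 0 * real x powr l)" by simp
  also have "\<dots> \<le> real n powr (- b) * (max C 0 * real x powr l)"
    using b\<beta> assms(5) by (intro mult_right_mono powr_mono) auto
  finally show ?thesis by (simp add: mult_ac)
qed

theorem theorem2p1:
  fixes \<omega> :: "nat \<Rightarrow> nat \<Rightarrow> real"
    and \<beta> :: "nat \<Rightarrow> real"
    and l \<mu> :: real
    and \<theta>\<^sub>1 :: "nat \<Rightarrow> real"
    and M :: "'a measure"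
    and Z :: "nat \<Rightarrow> 'a \<Rightarrow> nat \<times> nat"
  assumes "environment \<omega>"
    and "markov_chain M (init_prob \<omega>) (trans_prob \<omega>) Z"
    and "\<And>x. \<beta> x > 1"
    and "(INF x. \<beta> x) > 1"
    and "\<And>x. tail_const \<beta> \<omega> x < \<infinity>"
    and "0 \<le> l" and "l < min 1 ((INF x. \<beta> x) - 1)"
    and "\<exists>C::real. \<forall>x\<ge>1. tail_const \<beta> \<omega> x \<le> ereal (C * real x powr l)"
    and "\<mu> > 1"
    and "\<And>x. x \<ge> 1 \<Longrightarrow> 1 / real x * (\<Sum>w<x. mean_time \<omega> w) = \<mu> + \<theta>\<^sub>1 x"
    and "\<theta>\<^sub>1 \<in> o(\<lambda>_. 1)"
  shows "AE s in M. (\<lambda>n. inverse (real n) * real (fst (Z n s))) \<longlonglongrightarrow> inverse \<mu>"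
proof -
  interpret prob_space M using assms(2) unfolding markov_chain_def by blast
  interpret stepping_walk \<omega> M Z by standard (fact assms)+
  obtain C where C: "\<forall>x\<ge>1. tail_const \<beta> \<omega> x \<le> ereal (C * real x powr l)" using assms(8) by blast
  \<comment> \<open>The cap at 2 keeps \<gamma> below 1. The strict inequality
    \<open>1 + l < b\<close> survives it because \<open>l < 1\<close>.\<close>
  define b where "b = min 2 (INF x. \<beta> x)"
  have b: "1 + l < b" "b \<le> 2" "b \<le> (INF x. \<beta> x)" using assms(7) by (auto simp: b_def)
  \<comment> \<open>The gap between \<open>l\<close> and \<open>b - 1\<close> is halved: \<gamma> is
    the midpoint, hence above \<open>l\<close>, and \<epsilon> is the distance from there to
    \<open>b - 1\<close>.\<close>
  define \<gamma> \<epsilon> where "\<gamma> = (l + b - 1) / 2" and "\<epsilon> = (b - 1 - l) / 2"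
  have b_eq: "b = 1 + \<epsilon> + \<gamma>" by (simp add: \<gamma>_def \<epsilon>_def field_simps)
  have "(\<lambda>x. \<mu> + \<theta>\<^sub>1 x) \<longlonglongrightarrow> \<mu> + 0"
    using smalloD_tendsto[OF assms(11)] by (intro tendsto_add) auto
  then have lim: "(\<lambda>x. \<mu> + \<theta>\<^sub>1 x) \<longlonglongrightarrow> \<mu>" by simp
  have mean: "(\<lambda>x. (\<Sum>w<x. mean_time \<omega> w) / real x) \<longlonglongrightarrow> \<mu>"
  proof (rule Lim_transform_eventually[OF lim])
    show "\<forall>\<^sub>F x in sequentially. \<mu> + \<theta>\<^sub>1 x = (\<Sum>w<x. mean_time \<omega> w) / real x"
      by (intro eventually_sequentiallyI[of 1]) (simp flip: assms(10))
  qed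
  have "AE s in M. (\<lambda>x. real (\<tau> x s) / real x) \<longlonglongrightarrow> \<mu>"
  proof (rule AE_entry_time_LIMSEQ[OF _ _ _ _ _ _ mean])
    show "\<omega> i n \<le> max C 0 * real i powr l * real n powr (- (1 + \<epsilon> + \<gamma>))" if "i \<ge> 1" "n \<ge> 1" for i n
      using environment_tail_bound[OF assms(3) b(3) C that] unfolding b_eq .
  qed (use assms(6,7) b in \<open>auto simp: \<gamma>_def \<epsilon>_def\<close>)
  then show ?thesis using assms(9) by (intro AE_walk_speed) auto
qed

end
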